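(* Let $p>0$ with $p\ne\frac1n$ for every positive integer $n$. Then for every integer $m\ge 1$ and all real $y$, $$P_m^p(y)=\frac{1}{m\,B(m,\frac1p)}\;e^{-y}\;{}_1F_1\!\left(1-\tfrac1p,\;1-\tfrac1p-m,\;y\right).$$
   Context: The polynomials $P_m^p(y)$, for integers $m\ge 0$ and real $p>0$, are defined by $P_0^p(y)=1$, $P_1^p(y)=\frac1p-y$, and, for $m\ge 2$, $P_m^p(y)=\frac1m\left[\left(m-1+\frac1p-y\right)P_{m-1}^p(y)+y\,P_{m-2}^p(y)\right]$. $B(a,b)=\frac{\Gamma(a)\Gamma(b)}{\Gamma(a+b)}$ is the Beta function, and ${}_1F_1(\alpha,\gamma,y)=\sum_{k\ge0}\frac{(\alpha)_k}{(\gamma)_k}\frac{y^k}{k!}$ is the confluent hypergeometric function, where $(\alpha)_k=\alpha(\alpha+1)\cdots(\alpha+k-1)$. *)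

theory Defs
  imports "HOL-Analysis.Analysis"
begin

fun Pmp :: "real \<Rightarrow> nat \<Rightarrow> real \<Rightarrow> real" where
  "Pmp p 0 y = 1"
| "Pmp p (Suc 0) y = 1 / p - y"
| "Pmp p (Suc (Suc m)) y =
     1 / real (m + 2) * ((real (m + 1) + 1 / p - y) * Pmp p (Suc m) y + y * Pmp p m y)"

(* Kummer's series. The intended domain is c not in {0, -1, -2, ...}, where the
   denominators do not vanish and the series converges absolutely for every y; elsewhere
   terms with pochhammer c k = 0 silently become 0. *)
definition hyp_1F1 :: "real \<Rightarrow> real \<Rightarrow> real \<Rightarrow> real" where
  "hyp_1F1 a c y = (\<Sum>k. pochhammer a k / pochhammer c k * (y ^ k / fact k))"

end

theory Submission
  imports Defs
begin

text \<open>
  Put \<open>a = 1/p\<close>. Multiplying the recursion by \<open>t\<^sup>m\<close> and summing shows that the generating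
  function of the polynomials is \<open>(1 - t)\<close> to the power \<open>-a\<close>, times \<open>exp (- y t)\<close>. Hence
  \<open>exp y * P\<^sub>m(y)\<close> is the coefficient of \<open>t\<^sup>m\<close> in
  \<open>\<Sum>k. (1 - t) powr (k - a) * y\<^sup>k / k!\<close>. By the binomial series this coefficient is
  \<open>\<Sum>k. (a - k)\<^sub>m / m! * y\<^sup>k / k!\<close>.

  Knowing this series, one can verify it without generating functions: its coefficients
  satisfy the recursion of the polynomials, a factor \<open>y\<close> acting as an index shift
  (lemma \<open>Pmp_exp_sums\<close>). It is Kummer's series up to a constant, because
  \<open>(a)\<^sub>m (1 - a)\<^sub>k = (a - k)\<^sub>m (1 - a - m)\<^sub>k\<close> (lemma \<open>pochhammer_reflect_exchange\<close>): the two sides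
  are the products over adjacent runs of one arithmetic progression, split in two ways.
  The constant \<open>(a)\<^sub>m / m!\<close> is the Beta factor.
\<close>

text \<open>
  Both sides are, up to the common sign \<open>(-1)\<^sup>k\<close>, the product of the numbers
  \<open>a - k, \<dots>, a + m - 1\<close>: on the left it is cut below \<open>a\<close>, on the right below \<open>a + m - k\<close>.
\<close>
lemma pochhammer_reflect_exchange:
  fixes a :: "'a :: comm_ring_1"
  shows "pochhammer a m * pochhammer (1 - a) k =
         pochhammer (a - of_nat k) m * pochhammer (1 - a - of_nat m) k"
proof (induction k)
  case 0
  show ?case by simp
next
  case (Suc k)
  define x where "x = a - of_nat (Suc k)"
  have shift: "x * pochhammer (x + 1) m = pochhammer x m * (x + of_nat m)"
    by (metis pochhammer_rec pochhammer_Suc)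
  have x1: "x + 1 = a - of_nat k"
    by (simp add: x_def)
  have "pochhammer a m * pochhammer (1 - a) (Suc k) =
        (pochhammer a m * pochhammer (1 - a) k) * (- x)"
    by (simp add: pochhammer_Suc x_def algebra_simps)
  also have "\<dots> = - (x * pochhammer (x + 1) m) * pochhammer (1 - a - of_nat m) k"
    by (simp add: Suc.IH x1)
  also have "\<dots> = pochhammer x m * (pochhammer (1 - a - of_nat m) k * (- x - of_nat m))"
    unfolding shift by (simp add: algebra_simps)
  also have "- x - of_nat m = 1 - a - of_nat m + of_nat k"
    by (simp add: x_def)
  finally show ?case
    by (simp add: pochhammer_Suc x_def)
qed

text \<open>
  Multiplying an exponential series by \<open>y\<close> turns the coefficient \<open>c k\<close> into \<open>k * c (k - 1)\<close>;
  at \<open>k = 0\<close> the factor \<open>k\<close> annihilates the truncated index.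
\<close>
lemma sums_exponential_times_var:
  fixes c :: "nat \<Rightarrow> real"
  assumes "(\<lambda>k. c k * (y ^ k / fact k)) sums s"
  shows "(\<lambda>k. real k * c (k - 1) * (y ^ k / fact k)) sums (y * s)"
proof -
  have "(\<lambda>k. y * (c k * (y ^ k / fact k))) sums (y * s)"
    by (rule sums_mult[OF assms])
  also have "(\<lambda>k. y * (c k * (y ^ k / fact k))) =
             (\<lambda>k. real (Suc k) * c (Suc k - 1) * (y ^ Suc k / fact (Suc k)))"
    by (rule ext) (simp add: divide_simps)
  finally show ?thesis
    by (subst (asm) sums_Suc_iff) simp
qed

text \<open>
  This is the recursion of the polynomials read off on the coefficient of \<open>y\<^sup>k / k!\<close> in
  \<open>exp y * P\<^sub>m(y)\<close>, with \<open>x = a - k\<close>. The terms in \<open>k\<close> cancel: this is the Pascal-type rule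
  \<open>(x)\<^sub>m\<^sub>+\<^sub>1 = (x + 1)\<^sub>m\<^sub>+\<^sub>1 - (m + 1) (x + 1)\<^sub>m\<close>.
\<close>
lemma pochhammer_fact_recurrence:
  fixes x k :: real
  shows "pochhammer x (Suc (Suc m)) / fact (Suc (Suc m)) =
         1 / real (m + 2) *
         ((real (m + 1) + (x + k)) * (pochhammer x (Suc m) / fact (Suc m))
          - k * (pochhammer (x + 1) (Suc m) / fact (Suc m))
          + k * (pochhammer (x + 1) m / fact m))"
proof -
  have top: "pochhammer x (Suc (Suc m)) = pochhammer x (Suc m) * (x + real (m + 1))"
    by (simp add: pochhammer_Suc)
  have pascal: "pochhammer x (Suc m) =
      pochhammer (x + 1) (Suc m) - real (m + 1) * pochhammer (x + 1) m"
    by (subst pochhammer_rec, subst pochhammer_Suc) (simp add: algebra_simps)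
  have "pochhammer x (Suc (Suc m)) =
      (real (m + 1) + (x + k)) * pochhammer x (Suc m)
      - k * pochhammer (x + 1) (Suc m) + k * (real (m + 1) * pochhammer (x + 1) m)"
  proof -
    have "k * pochhammer x (Suc m) =
        k * (pochhammer (x + 1) (Suc m) - real (m + 1) * pochhammer (x + 1) m)"
      by (simp only: pascal)
    then show ?thesis
      unfolding top by algebra
  qed
  \<comment> \<open>Division by \<open>(m + 2)!\<close> written as \<open>A * (B * F)\<close>, with the factors kept abstract so
    that clearing denominators does not multiply out the numerals.\<close>
  moreover have "P / (A * (B * F)) = 1 / A * (u * (q / (B * F)) - k * (r / (B * F)) + k * (s / F))"
    if "P = u * q - k * r + k * (B * s)" "A \<noteq> 0" "B \<noteq> 0" "F \<noteq> 0"
    for P A B F u q r s :: real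
    using that by (simp add: field_simps)
  moreover have "fact (Suc (Suc m)) = real (m + 2) * (real (m + 1) * fact m)"
    "fact (Suc m) = real (m + 1) * fact m"
    by simp_all
  moreover have "real (m + 2) \<noteq> 0" "real (m + 1) \<noteq> 0" "fact m \<noteq> (0::real)"
    by simp_all
  ultimately show ?thesis
    by presburger
qed

text \<open>
  The three-term recursion carries over term by term, so the induction also yields the
  convergence of the series.
\<close>
lemma Pmp_exp_sums:
  "(\<lambda>k. pochhammer (1 / p - real k) m / fact m * (y ^ k / fact k)) sums (exp y * Pmp p m y)"
proof (induction p m y rule: Pmp.induct)
  case (1 p y)
  show ?case
    using exp_converges[of y] by (simp add: field_simps)
next
  case (2 p y)
  have E: "(\<lambda>k. 1 * (y ^ k / fact k)) sums exp y"
    using exp_converges[of y] by (simp add: field_simps)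
  have "(\<lambda>k. 1 / p * (1 * (y ^ k / fact k)) - real k * 1 * (y ^ k / fact k))
        sums (1 / p * exp y - y * exp y)"
    by (intro sums_diff sums_mult E sums_exponential_times_var[OF E])
  then show ?case
    by (simp add: algebra_simps diff_divide_distrib)
next
  case (3 p m y)
  define c where "c j k = pochhammer (1 / p - real k) j / fact j" for j k
  have IH1: "(\<lambda>k. c (Suc m) k * (y ^ k / fact k)) sums (exp y * Pmp p (Suc m) y)"
    and IH0: "(\<lambda>k. c m k * (y ^ k / fact k)) sums (exp y * Pmp p m y)"
    using "3.IH" by (simp_all add: c_def)
  have "(\<lambda>k. 1 / real (m + 2) *
           ((real (m + 1) + 1 / p) * (c (Suc m) k * (y ^ k / fact k))
            - real k * c (Suc m) (k - 1) * (y ^ k / fact k)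
            + real k * c m (k - 1) * (y ^ k / fact k)))
        sums (1 / real (m + 2) *
           ((real (m + 1) + 1 / p) * (exp y * Pmp p (Suc m) y)
            - y * (exp y * Pmp p (Suc m) y) + y * (exp y * Pmp p m y)))"
    by (intro sums_mult sums_add sums_diff IH1
        sums_exponential_times_var[OF IH1] sums_exponential_times_var[OF IH0])
  also have "1 / real (m + 2) *
           ((real (m + 1) + 1 / p) * (exp y * Pmp p (Suc m) y)
            - y * (exp y * Pmp p (Suc m) y) + y * (exp y * Pmp p m y)) =
        exp y * Pmp p (Suc (Suc m)) y"
    by (simp add: algebra_simps)
  also have "(\<lambda>k. 1 / real (m + 2) *
           ((real (m + 1) + 1 / p) * (c (Suc m) k * (y ^ k / fact k))
            - real k * c (Suc m) (k - 1) * (y ^ k / fact k)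
            + real k * c m (k - 1) * (y ^ k / fact k))) =
        (\<lambda>k. c (Suc (Suc m)) k * (y ^ k / fact k))"
  proof
    fix k
    have shift: "real k * c j (k - 1) =
        real k * (pochhammer (1 / p - real k + 1) j / fact j)" for j
      by (cases k) (simp_all add: c_def)
    have "c (Suc (Suc m)) k = 1 / real (m + 2) *
        ((real (m + 1) + 1 / p) * c (Suc m) k
         - real k * c (Suc m) (k - 1) + real k * c m (k - 1))"
      unfolding shift
      using pochhammer_fact_recurrence[of "1 / p - real k" m "real k"]
      by (simp only: c_def diff_add_cancel)
    then show "1 / real (m + 2) *
           ((real (m + 1) + 1 / p) * (c (Suc m) k * (y ^ k / fact k))
            - real k * c (Suc m) (k - 1) * (y ^ k / fact k)
            + real k * c m (k - 1) * (y ^ k / fact k)) =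
        c (Suc (Suc m)) k * (y ^ k / fact k)"
      by (simp only: ring_distribs mult.assoc)
  qed
  finally show ?case
    by (simp only: c_def)
qed

lemma inverse_Beta_nat_eq_pochhammer:
  fixes a :: real
  assumes "a > 0" "m \<ge> 1"
  shows "1 / (real m * Beta (real m) a) = pochhammer a m / fact m"
proof -
  have "a \<notin> \<int>\<^sub>\<le>\<^sub>0"
    using assms(1) by (auto elim!: nonpos_Ints_cases)
  then have "pochhammer a m = Gamma (a + real m) / Gamma a"
    by (simp add: pochhammer_Gamma)
  moreover have "real m * Gamma (real m) = fact m"
    using assms(2) Gamma_fact[of "m - 1", where 'a = real] fact_reduce[of m, where 'a = real]
    by (simp add: of_nat_diff)
  ultimately show ?thesis
    by (simp add: Beta_def add.commute)
qed

theorem corollary15: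
  fixes p y :: real and m :: nat
  assumes "p > 0"
    and "\<And>n::nat. n \<ge> 1 \<Longrightarrow> p \<noteq> 1 / real n"
    and "m \<ge> 1"
  shows "Pmp p m y = 1 / (real m * Beta (real m) (1 / p)) * exp (- y) *
           hyp_1F1 (1 - 1 / p) (1 - 1 / p - real m) y"
proof -
  define a where "a = 1 / p"
  have "a > 0"
    using assms(1) by (simp add: a_def)
  \<comment> \<open>\<open>1 - a - m = -n\<close> would make \<open>1/p = n + 1 - m\<close> a positive integer.\<close>
  have denom: "pochhammer (1 - a - real m) k \<noteq> 0" for k
  proof
    assume "pochhammer (1 - a - real m) k = 0"
    then obtain n where "1 - a - real m = - real n"
      by (auto simp: pochhammer_eq_0_iff)
    then have n: "a = real (n + 1) - real m"
      by simp
    then have "m < n + 1"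
      using \<open>a > 0\<close> by linarith
    then have "a = real (n + 1 - m)" "n + 1 - m \<ge> 1"
      using n by (simp_all add: of_nat_diff)
    then show False
      using assms(2)[of "n + 1 - m"] assms(1) by (simp add: a_def field_simps)
  qed
  have pos: "pochhammer a m / fact m > 0"
    using \<open>a > 0\<close> by (simp add: pochhammer_pos)
  have "pochhammer (a - real k) m / fact m =
      pochhammer a m / fact m * (pochhammer (1 - a) k / pochhammer (1 - a - real m) k)" for k
    using pochhammer_reflect_exchange[of a m k] denom[of k] by (simp add: field_simps)
  then have "(\<lambda>k. pochhammer a m / fact m *
        (pochhammer (1 - a) k / pochhammer (1 - a - real m) k * (y ^ k / fact k)))
      sums (exp y * Pmp p m y)"
    using Pmp_exp_sums[of p m y] by (simp add: a_def mult.assoc)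
  then have "(\<lambda>k. pochhammer (1 - a) k / pochhammer (1 - a - real m) k * (y ^ k / fact k))
      sums (exp y * Pmp p m y / (pochhammer a m / fact m))"
    using pos by (intro sums_mult_D) auto
  then have "hyp_1F1 (1 - a) (1 - a - real m) y =
      exp y * Pmp p m y / (pochhammer a m / fact m)"
    unfolding hyp_1F1_def by (rule sums_unique[symmetric])
  then show ?thesis
    using pos inverse_Beta_nat_eq_pochhammer[OF \<open>a > 0\<close> assms(3)]
    by (auto simp: a_def[symmetric] exp_minus)
qed

end
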